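(* Let $(\mathcal{F},\mathsf{B})$ be a position which, for some positive integer $n$, is isomorphic to the position $(\mathcal{G}_n,\mathsf{A}_n)$. (1) If $n$ is odd then $(\mathcal{F},\mathsf{B})$ is an $\mathsf{N}$-position. (2) If $n$ is even then $(\mathcal{F},\mathsf{B})$ is a $\mathsf{P}$-position.
   Context: **The graphs $\mathcal{G}_n$ and sets $\mathsf{A}_n$.** $\mathcal{G}_1$ is the triangle with vertex set $\{1,2,3\}$ and edges $\{1,2\},\{1,3\},\{2,3\}$. Given $\mathcal{G}_n=(V_n,E_n)$ with $V_n=\{1,2,\dots,2n+1\}$, the graph $\mathcal{G}_{n+1}=(V_{n+1},E_{n+1})$ has $V_{n+1}=V_n\cup\{2n+2,2n+3\}$ and $E_{n+1}=E_n\cup\{\{2n+1,2n+2\},\{2n+1,2n+3\},\{2n+2,2n+3\}\}$. For each $n$, $\mathsf{A}_n=\{2\}\cup\{k\in V_n : k \bmod 4=0\}$. **The graph transformation gcds.** Let $\mathcal{G}=(V,E)$ be a graph and $\{x,y\}\in E$. The master list of $\{x,y\}$ has two columns: the first consists of all neighbors of $x$ in $\mathcal{G}$ except $y$, the second of all neighbors of $y$ in $\mathcal{G}$ except $x$. The graph $\mathbf{gcds}(\mathcal{G},\{x,y\})=(V,E')$ is defined as follows. Both $x$ and $y$ are isolated in it. For $p\ne q$ in $V\setminus\{x,y\}$: (a) if $p$ or $q$ is not in the master list, then $\{p,q\}\in E'$ iff $\{p,q\}\in E$; (b) if both are in the master list, then: (b.1) if no column contains both $p$ and $q$, then $\{p,q\}\in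 E'$ iff $\{p,q\}\notin E$; (b.2) if some column contains both and the total number of occurrences of $p$ and $q$ in the master list (both columns together) is even, then $\{p,q\}\in E'$ iff $\{p,q\}\in E$; (b.3) if some column contains both and that total number is odd, then $\{p,q\}\in E'$ iff $\{p,q\}\notin E$. **The modification $\mathbf{gcds}_2$.** For a finite graph $\mathcal{G}=(V,E)$ and $\{a,b\}\in E$, compute $(V,E')=\mathbf{gcds}(\mathcal{G},\{a,b\})$; then delete $a$ and $b$, and also delete every vertex $v$ in the master list of $\{a,b\}$ that is isolated in $(V,E')$, unless $v$ is the only vertex in the master list. With $V'$ the set of remaining vertices, $\mathbf{gcds}_2(\mathcal{G},\{a,b\})=(V',E')$. **The game and positions.** A position is a pair $(\mathcal{G},\mathsf{A})$ with $\mathcal{G}=(V,E)$ a finite graph and $\mathsf{A}$ a set (the vertices favorable to player ONE). From a position, players ONE and TWO alternate moves; a move consists of choosing an edge $\{a,b\}$ of the current graph $\mathcal{C}$ and replacing $\mathcal{C}$ by $\mathbf{gcds}_2(\mathcal{C},\{a,b\})$. Play ends when the current graph has no edges. If the vertex set of the final graph is nonempty and is a subset of $\mathsf{A}$, then ONE wins; otherwise TWO wins. (The game $\mathsf{GCDS}(\mathcal{G},\mathsf{A})$ is this game with ONE moving first.) Positions $(\mathcal{F}_1,\mathsf{B}_1)$ and $(\mathcal{F}_2,\mathsf{B}_2)$ are isomorphic if there is a graph isomorphism $f$ from $\mathcal{F}_1$ to $\mathcal{F}_2$ with $\mathsf{B}_2=\{f(b): b\in\mathsf{B}_1\}$. A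 position is a $\mathsf{P}$-position if the player whose move produced it (i.e. the player who is not next to move) has a winning strategy from it; it is an $\mathsf{N}$-position if the next player to move has a winning strategy from it. Both notions are understood for either choice of which of ONE, TWO is the next player to move. *)

theory Defs
  imports Main
begin

section \<open>Simple graphs and the transformation gcds\<close>

type_synonym 'a graph = "'a set \<times> 'a set set"

abbreviation verts :: "'a graph \<Rightarrow> 'a set" where
  "verts G \<equiv> fst G"

abbreviation edges :: "'a graph \<Rightarrow> 'a set set" where
  "edges G \<equiv> snd G"

definition finite_graph :: "'a graph \<Rightarrow> bool" where
  "finite_graph G \<longleftrightarrow> finite (verts G) \<and> (\<forall>e\<in>edges G. e \<subseteq> verts G \<and> card e = 2)"

definition neighbors :: "'a graph \<Rightarrow> 'a \<Rightarrow> 'a set" where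
  "neighbors G v = {w. {v, w} \<in> edges G}"

text \<open>For an edge \<open>e = {x, y}\<close> the two columns of its master list are indexed by the endpoints:
  \<open>column G e x\<close> consists of the neighbors of \<open>x\<close> except \<open>y\<close>, and vice versa.\<close>

definition column :: "'a graph \<Rightarrow> 'a set \<Rightarrow> 'a \<Rightarrow> 'a set" where
  "column G e z = neighbors G z - (e - {z})"

definition master_list :: "'a graph \<Rightarrow> 'a set \<Rightarrow> 'a set" where
  "master_list G e = (\<Union>z\<in>e. column G e z)"

definition occurrences :: "'a graph \<Rightarrow> 'a set \<Rightarrow> 'a \<Rightarrow> nat" where
  "occurrences G e p = card {z \<in> e. p \<in> column G e z}"

definition same_column :: "'a graph \<Rightarrow> 'a set \<Rightarrow> 'a \<Rightarrow> 'a \<Rightarrow> bool" where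
  "same_column G e p q \<longleftrightarrow> (\<exists>z\<in>e. p \<in> column G e z \<and> q \<in> column G e z)"

definition gcds_adjacent :: "'a graph \<Rightarrow> 'a set \<Rightarrow> 'a \<Rightarrow> 'a \<Rightarrow> bool" where
  "gcds_adjacent G e p q \<longleftrightarrow>
     (if p \<notin> master_list G e \<or> q \<notin> master_list G e then {p, q} \<in> edges G
      else if \<not> same_column G e p q then {p, q} \<notin> edges G
      else if even (occurrences G e p + occurrences G e q) then {p, q} \<in> edges G
      else {p, q} \<notin> edges G)"

definition gcds :: "'a graph \<Rightarrow> 'a set \<Rightarrow> 'a graph" where
  "gcds G e =
     (verts G,
      {{p, q} | p q. p \<in> verts G - e \<and> q \<in> verts G - e \<and> p \<noteq> q \<and> gcds_adjacent G e p q})"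

definition gcds2 :: "'a graph \<Rightarrow> 'a set \<Rightarrow> 'a graph" where
  "gcds2 G e =
     (verts G - e - {v \<in> master_list G e. neighbors (gcds G e) v = {} \<and> master_list G e \<noteq> {v}},
      edges (gcds G e))"

section \<open>The game\<close>

type_synonym 'a position = "'a graph \<times> 'a set"

definition is_position :: "'a position \<Rightarrow> bool" where
  "is_position P \<longleftrightarrow> finite_graph (fst P)"

datatype player = ONE | TWO

fun opponent :: "player \<Rightarrow> player" where
  "opponent ONE = TWO"
| "opponent TWO = ONE"

text \<open>A partial play is the list of edges chosen so far, in chronological order. Every move removes
  the two endpoints of the chosen edge, so plays on finite graphs are finite.\<close>

fun legal_play :: "'a graph \<Rightarrow> 'a set list \<Rightarrow> bool" where
  "legal_play G [] \<longleftrightarrow> True"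
| "legal_play G (e # ms) \<longleftrightarrow> e \<in> edges G \<and> legal_play (gcds2 G e) ms"

definition graph_after :: "'a graph \<Rightarrow> 'a set list \<Rightarrow> 'a graph" where
  "graph_after G ms = foldl gcds2 G ms"

definition to_move :: "player \<Rightarrow> 'a set list \<Rightarrow> player" where
  "to_move first ms = (if even (length ms) then first else opponent first)"

definition winner :: "'a set \<Rightarrow> 'a graph \<Rightarrow> player" where
  "winner A G = (if verts G \<noteq> {} \<and> verts G \<subseteq> A then ONE else TWO)"

text \<open>A strategy answers the moves made so far by an edge.\<close>

type_synonym 'a strategy = "'a set list \<Rightarrow> 'a set"

definition consistent :: "player \<Rightarrow> player \<Rightarrow> 'a strategy \<Rightarrow> 'a set list \<Rightarrow> bool" where
  "consistent first p \<sigma> ms \<longleftrightarrow>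
     (\<forall>k<length ms. to_move first (take k ms) = p \<longrightarrow> ms ! k = \<sigma> (take k ms))"

text \<open>The first conjunct of the conclusion, legality of the prescribed moves, excludes strategies
  that would win vacuously by getting stuck.\<close>

definition winning_strategy :: "'a position \<Rightarrow> player \<Rightarrow> player \<Rightarrow> 'a strategy \<Rightarrow> bool" where
  "winning_strategy P first p \<sigma> \<longleftrightarrow>
     (\<forall>ms. legal_play (fst P) ms \<and> consistent first p \<sigma> ms \<longrightarrow>
        (edges (graph_after (fst P) ms) \<noteq> {} \<and> to_move first ms = p
           \<longrightarrow> \<sigma> ms \<in> edges (graph_after (fst P) ms)) \<and>
        (edges (graph_after (fst P) ms) = {}
           \<longrightarrow> winner (snd P) (graph_after (fst P) ms) = p))"

definition N_position :: "'a position \<Rightarrow> bool" where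
  "N_position P \<longleftrightarrow> (\<forall>next_player. \<exists>\<sigma>. winning_strategy P next_player next_player \<sigma>)"

definition P_position :: "'a position \<Rightarrow> bool" where
  "P_position P \<longleftrightarrow> (\<forall>next_player. \<exists>\<sigma>. winning_strategy P next_player (opponent next_player) \<sigma>)"

definition graph_isomorphism :: "('a \<Rightarrow> 'b) \<Rightarrow> 'a graph \<Rightarrow> 'b graph \<Rightarrow> bool" where
  "graph_isomorphism f G H \<longleftrightarrow>
     bij_betw f (verts G) (verts H) \<and>
     (\<forall>x\<in>verts G. \<forall>y\<in>verts G. {x, y} \<in> edges G \<longleftrightarrow> {f x, f y} \<in> edges H)"

text \<open>A graph isomorphism is only meaningful on the vertices, whence the condition that the set of
  favorable vertices of the first position lies inside its vertex set.\<close>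

definition isomorphic_positions :: "'a position \<Rightarrow> 'b position \<Rightarrow> bool" where
  "isomorphic_positions P Q \<longleftrightarrow>
     (\<exists>f. graph_isomorphism f (fst P) (fst Q) \<and> snd P \<subseteq> verts (fst P) \<and> snd Q = f ` snd P)"

section \<open>The chain of triangles and its favorable vertices\<close>

text \<open>The value at \<open>0\<close> is only a seed chosen so that the recursion yields the triangle
  at \<open>1\<close>.\<close>

fun triangle_chain :: "nat \<Rightarrow> nat graph" where
  "triangle_chain 0 = ({1}, {})"
| "triangle_chain (Suc n) =
     (verts (triangle_chain n) \<union> {2*n + 2, 2*n + 3},
      edges (triangle_chain n) \<union>
        {{2*n + 1, 2*n + 2}, {2*n + 1, 2*n + 3}, {2*n + 2, 2*n + 3}})"

lemma triangle_chain_1: "triangle_chain 1 = ({1, 2, 3}, {{1, 2}, {1, 3}, {2, 3}})"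
  by (auto simp: numeral_eq_Suc)

lemma verts_triangle_chain: "verts (triangle_chain n) = {1..2*n + 1}"
  by (induction n) auto

definition favorable :: "nat \<Rightarrow> nat set" where
  "favorable n = {2} \<union> {k \<in> verts (triangle_chain n). k mod 4 = 0}"

end

theory Submission
  imports Defs "HOL-Library.Z2"
begin

text \<open>Over the field with two elements, gcds is the Schur complement of the adjacency matrix with respect
  to the block of the chosen edge. The kernel of the adjacency matrix of the chain of triangles is
  spanned by the all-ones vector, and this property survives Schur complements. Hence no vertex
  besides the endpoints is ever deleted before the end, and a play starting from \<open>n\<close> triangles consists of exactly
  \<open>n\<close> moves and leaves a single vertex. Whoever moves last wins. If this is TWO, it suffices to remove
  a favorable vertex with every move. If this is ONE, then ONE answers every move of TWO so that
  the resulting graph is a chain with two triangles less, whose favorable vertices were favorable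
  before.\<close>

section \<open>From forced wins to winning strategies\<close>

text \<open>Backward induction in the game tree: \<open>p\<close> wins with \<open>q\<close> to
  move. It speaks of graphs alone and so avoids the move histories that strategies depend
  on.\<close>

inductive forces :: "'a set \<Rightarrow> player \<Rightarrow> player \<Rightarrow> 'a graph \<Rightarrow> bool" for B p where
  final: "edges G = {} \<Longrightarrow> winner B G = p \<Longrightarrow> forces B p q G"
| own: "e \<in> edges G \<Longrightarrow> forces B p (opponent p) (gcds2 G e) \<Longrightarrow> forces B p p G"
| other: "edges G \<noteq> {} \<Longrightarrow> (\<And>e. e \<in> edges G \<Longrightarrow> forces B p p (gcds2 G e)) \<Longrightarrow> forces B p (opponent p) G"

lemma opponent_simps [simp]: "opponent (opponent q) = q" "opponent q \<noteq> q" "q \<noteq> opponent q"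
  by (cases q; simp)+

lemma graph_after_simps [simp]:
  "graph_after G [] = G" "graph_after G (e # ms) = graph_after (gcds2 G e) ms"
  by (simp_all add: graph_after_def)

lemma to_move_simps [simp]:
  "to_move q [] = q" "to_move q (e # ms) = to_move (opponent q) ms"
  by (simp_all add: to_move_def)

lemma consistent_Cons:
  "consistent q p \<sigma> (e # ms) \<longleftrightarrow>
     (q = p \<longrightarrow> e = \<sigma> []) \<and> consistent (opponent q) p (\<lambda>ms. \<sigma> (e # ms)) ms"
  unfolding consistent_def by (auto simp: less_Suc_eq_0_disj all_conj_distrib)

text \<open>After a first move \<open>e\<close> a strategy continues as its shift by the prefix
  \<open>e\<close>. Thus winning unfolds into one legal step and winning shifts, in the pattern of
  the rules of \<open>forces\<close>.\<close>

lemma winning_strategy_move: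
  assumes "edges G \<noteq> {}" and "q = p \<Longrightarrow> \<sigma> [] \<in> edges G"
    and "\<And>e. e \<in> edges G \<Longrightarrow> (q = p \<Longrightarrow> e = \<sigma> []) \<Longrightarrow>
           winning_strategy (gcds2 G e, B) (opponent q) p (\<lambda>ms. \<sigma> (e # ms))"
  shows "winning_strategy (G, B) q p \<sigma>"
  unfolding winning_strategy_def
proof (intro allI impI)
  fix ms assume ms: "legal_play (fst (G, B)) ms \<and> consistent q p \<sigma> ms"
  show "(edges (graph_after (fst (G, B)) ms) \<noteq> {} \<and> to_move q ms = p
           \<longrightarrow> \<sigma> ms \<in> edges (graph_after (fst (G, B)) ms)) \<and>
        (edges (graph_after (fst (G, B)) ms) = {}
           \<longrightarrow> winner (snd (G, B)) (graph_after (fst (G, B)) ms) = p)"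
  proof (cases ms)
    case Nil
    then show ?thesis using assms(1,2) by simp
  next
    case (Cons e ns)
    then have "winning_strategy (gcds2 G e, B) (opponent q) p (\<lambda>ms. \<sigma> (e # ms))"
      using ms by (intro assms(3)) (auto simp: consistent_Cons)
    then show ?thesis
      using ms Cons unfolding winning_strategy_def by (auto simp: consistent_Cons)
  qed
qed

lemma forces_imp_winning_strategy:
  "forces B p q G \<Longrightarrow> \<exists>\<sigma>. winning_strategy (G, B) q p \<sigma>"
proof (induction rule: forces.induct)
  case (final G q)
  have "ms = []" if "legal_play G ms" for ms
    using that final(1) by (cases ms) auto
  with final have "winning_strategy (G, B) q p \<sigma>" for \<sigma>
    by (auto simp: winning_strategy_def dest!: \<open>\<And>ms. legal_play G ms \<Longrightarrow> ms = []\<close>)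
  then show ?case by blast
next
  case (own e G)
  then obtain \<sigma> where "winning_strategy (gcds2 G e, B) (opponent p) p \<sigma>"
    by blast
  with own(1) have "winning_strategy (G, B) p p (\<lambda>ms. case ms of [] \<Rightarrow> e | _ # ns \<Rightarrow> \<sigma> ns)"
    by - (rule winning_strategy_move, auto)
  then show ?case by blast
next
  case (other G)
  then have "\<forall>e\<in>edges G. \<exists>\<sigma>. winning_strategy (gcds2 G e, B) p p \<sigma>"
    by blast
  from bchoice[OF this] obtain \<tau> where "\<forall>e\<in>edges G. winning_strategy (gcds2 G e, B) p p (\<tau> e)" ..
  \<comment> \<open>The opponent's first move selects the strategy. The value at \<open>[]\<close>
    is arbitrary, as \<open>p\<close> is not to move there.\<close>
  with other(1) have "winning_strategy (G, B) (opponent p) p (\<lambda>ms. \<tau> (hd ms) (tl ms))"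
    by - (rule winning_strategy_move, auto)
  then show ?case by blast
qed

section \<open>Pivots over the field with two elements\<close>

definition adj :: "'a graph \<Rightarrow> 'a \<Rightarrow> 'a \<Rightarrow> bool" where
  "adj G p q \<longleftrightarrow> {p, q} \<in> edges G"

text \<open>An entry of the Schur complement modulo 2: on truth values \<open>\<noteq>\<close> is
  addition, and the block of the edge, with rows 01 and 10, is its own inverse.\<close>

definition pivot :: "('a \<Rightarrow> 'a \<Rightarrow> bool) \<Rightarrow> 'a \<Rightarrow> 'a \<Rightarrow> 'a \<Rightarrow> 'a \<Rightarrow> bool" where
  "pivot r x y p q \<longleftrightarrow> (r p q \<noteq> (r x p \<and> r y q)) \<noteq> (r y p \<and> r x q)"

lemma adj_commute: "adj G p q \<longleftrightarrow> adj G q p"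
  by (simp add: adj_def insert_commute)

lemma adjD:
  assumes "finite_graph G" "adj G p q"
  shows "p \<in> verts G" "q \<in> verts G" "p \<noteq> q"
  using assms unfolding finite_graph_def adj_def by (auto dest!: bspec)

lemma edgeE:
  assumes "finite_graph G" "e \<in> edges G"
  obtains p q where "e = {p, q}" "adj G p q"
  using assms unfolding finite_graph_def adj_def by (metis card_2_iff)

text \<open>Encode \<open>p\<close> and \<open>q\<close> by their adjacencies to \<open>x\<close>
  and \<open>y\<close>, as vectors of length 2 over the field with two elements. The correction in
  \<open>pivot\<close> is the alternating form, which is 1 exactly for two distinct nonzero vectors.
  Nonzero means lying in the master list. Distinct nonzero vectors either share no column or have
  three occurrences in total, and these are the two cases of a flip.\<close>

lemma adj_gcds:
  assumes G: "finite_graph G" and xy: "adj G x y" and p: "p \<in> verts G - {x, y}" and q: "q \<in> verts G - {x, y}"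
  shows "adj (gcds G {x, y}) p q \<longleftrightarrow> pivot (adj G) x y p q"
proof -
  have "x \<noteq> y" using adjD[OF G xy] by simp
  have neq: "\<not> adj G z z" for z using adjD[OF G] by blast
  have col: "p \<in> column G {x, y} x \<longleftrightarrow> adj G x p" "p \<in> column G {x, y} y \<longleftrightarrow> adj G y p"
    if "p \<in> verts G - {x, y}" for p
    using that by (auto simp: column_def neighbors_def adj_def)
  have ml: "p \<in> master_list G {x, y} \<longleftrightarrow> adj G x p \<or> adj G y p"
    if "p \<in> verts G - {x, y}" for p
    using col[OF that] by (auto simp: master_list_def)
  have same: "same_column G {x, y} p q \<longleftrightarrow> adj G x p \<and> adj G x q \<or> adj G y p \<and> adj G y q"
    using col[OF p] col[OF q] by (auto simp: same_column_def)
  have occ: "occurrences G {x, y} p = of_bool (adj G x p) + of_bool (adj G y p)"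
    if "p \<in> verts G - {x, y}" for p
  proof -
    have "{z \<in> {x, y}. p \<in> column G {x, y} z} = (if adj G x p then {x} else {}) \<union> (if adj G y p then {y} else {})"
      using col[OF that] by auto
    then show ?thesis using \<open>x \<noteq> y\<close> by (auto simp: occurrences_def)
  qed
  have ga: "gcds_adjacent G {x, y} p q \<longleftrightarrow> pivot (adj G) x y p q"
    unfolding gcds_adjacent_def ml[OF p] ml[OF q] same occ[OF p] occ[OF q] adj_def[symmetric]
    by (auto simp: pivot_def)
  have sym: "gcds_adjacent G {x, y} q p \<longleftrightarrow> gcds_adjacent G {x, y} p q"
    unfolding gcds_adjacent_def by (simp add: same_column_def insert_commute conj_commute disj_commute add.commute)
  have "adj (gcds G {x, y}) p q \<longleftrightarrow> p \<noteq> q \<and> gcds_adjacent G {x, y} p q"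
    unfolding adj_def[of "gcds G {x, y}"] using p q sym
    by (auto simp: gcds_def doubleton_eq_iff)
  \<comment> \<open>For \<open>p = q\<close> the pivot is false: there are no loops, and the two
    products coincide.\<close>
  also have "\<dots> \<longleftrightarrow> pivot (adj G) x y p q"
    unfolding ga using neq by (auto simp: pivot_def)
  finally show ?thesis .
qed

text \<open>The kernel of the adjacency matrix over the field with two elements consists of the constant vectors.\<close>

definition corank_one :: "'a graph \<Rightarrow> bool" where
  "corank_one G \<longleftrightarrow> finite_graph G \<and>
     (\<forall>v\<in>verts G. (\<Sum>u\<in>verts G. of_bool (adj G v u) :: bit) = 0) \<and>
     (\<forall>f :: 'a \<Rightarrow> bit. (\<forall>v\<in>verts G. (\<Sum>u\<in>verts G. of_bool (adj G v u) * f u) = 0) \<longrightarrow>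
        (\<forall>u\<in>verts G. \<forall>w\<in>verts G. f u = f w))"

lemma corank_one_finite: "corank_one G \<Longrightarrow> finite_graph G"
  unfolding corank_one_def by blast

lemma corank_one_kernel:
  fixes f :: "'a \<Rightarrow> bit"
  assumes "corank_one G" "\<And>v. v \<in> verts G \<Longrightarrow> (\<Sum>u\<in>verts G. of_bool (adj G v u) * f u) = 0"
    and "u \<in> verts G" "w \<in> verts G"
  shows "f u = f w"
  using assms(1)[unfolded corank_one_def, THEN conjunct2, THEN conjunct2, rule_format, of f u w] assms(2-4)
  by blast

text \<open>The indicator function of an isolated vertex lies in the kernel, hence is
  constant.\<close>

lemma corank_one_isolated:
  assumes "corank_one G" "v \<in> verts G" "neighbors G v = {}"
  shows "verts G = {v}"
proof -
  have na: "\<not> adj G w v" for w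
    using assms(3) by (auto simp: neighbors_def adj_def insert_commute)
  have "u = v" if "u \<in> verts G" for u
  proof -
    have "(of_bool (u = v) :: bit) = of_bool (v = v)"
    proof (rule corank_one_kernel[OF assms(1) _ that assms(2), where f = "\<lambda>u. of_bool (u = v)"])
      show "(\<Sum>u\<in>verts G. of_bool (adj G w u) * (of_bool (u = v) :: bit)) = 0" for w
        using na by (intro sum.neutral) auto
    qed
    then show "u = v" by simp
  qed
  with assms(2) show ?thesis by blast
qed

lemma of_bool_pivot:
  "(of_bool (pivot r x y p q) :: bit) =
     of_bool (r p q) + of_bool (r x p) * of_bool (r y q) + of_bool (r y p) * of_bool (r x q)"
  by (auto simp: pivot_def)

text \<open>Kernel vectors of the Schur complement are the restrictions of kernel vectors of the
  whole matrix: the all-ones vector restricts, and conversely every kernel vector extends to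
  \<open>x\<close> and \<open>y\<close>.\<close>

lemma corank_one_gcds:
  assumes G: "corank_one G" and xy: "adj G x y"
  shows "corank_one (verts G - {x, y}, edges (gcds G {x, y}))" (is "corank_one ?H")
proof -
  let ?V = "verts G - {x, y}"
  let ?a = "\<lambda>p q. of_bool (adj G p q) :: bit"
  have fin: "finite_graph G" and finV: "finite (verts G)"
    using corank_one_finite[OF G] by (auto simp: finite_graph_def)
  have ker1: "(\<Sum>u\<in>verts G. ?a v u) = 0" if "v \<in> verts G" for v
    using G that unfolding corank_one_def by blast
  have ker: "f u = f w" if "\<And>v. v \<in> verts G \<Longrightarrow> (\<Sum>u\<in>verts G. ?a v u * f u) = 0" "u \<in> verts G" "w \<in> verts G"
    for f :: "'a \<Rightarrow> bit" and u w
    using corank_one_kernel[OF G that] .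
  have xyV: "x \<in> verts G" "y \<in> verts G" "x \<noteq> y" using adjD[OF fin xy] by auto
  have irr: "\<not> adj G z z" for z using adjD[OF fin] by blast
  have split: "(\<Sum>u\<in>verts G. g u) = g x + g y + (\<Sum>u\<in>?V. g u)" for g :: "'a \<Rightarrow> bit"
  proof -
    have "sum g (verts G) = sum g (insert x (insert y ?V))" using xyV by (intro sum.cong) auto
    also have "\<dots> = g x + (g y + sum g ?V)" using finV xyV(3) by (subst sum.insert; simp)
    finally show ?thesis by (simp only: add.assoc)
  qed
  have adjH: "adj ?H p q \<longleftrightarrow> pivot (adj G) x y p q" if "p \<in> ?V" "q \<in> ?V" for p q
    using adj_gcds[OF fin xy that] by (simp add: adj_def)
  have sumH: "(\<Sum>u\<in>?V. of_bool (adj ?H v u) * f u) =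
      (\<Sum>u\<in>?V. ?a v u * f u) + ?a x v * (\<Sum>u\<in>?V. ?a y u * f u) + ?a y v * (\<Sum>u\<in>?V. ?a x u * f u)"
    if "v \<in> ?V" for v and f :: "'a \<Rightarrow> bit"
  proof -
    have "(\<Sum>u\<in>?V. of_bool (adj ?H v u) * f u) =
        (\<Sum>u\<in>?V. ?a v u * f u + ?a x v * (?a y u * f u) + ?a y v * (?a x u * f u))"
      by (intro sum.cong refl) (simp only: adjH[OF that] of_bool_pivot distrib_right mult.assoc)
    then show ?thesis by (simp only: sum.distrib sum_distrib_left)
  qed
  have *: "\<forall>v\<in>?V. (\<Sum>u\<in>?V. of_bool (adj ?H v u) :: bit) = 0"
  proof
    fix v assume v: "v \<in> ?V"
    \<comment> \<open>Row \<open>x\<close> has sum 0 and its entry at \<open>y\<close> is 1; the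
      same holds with \<open>x\<close> and \<open>y\<close> exchanged.\<close>
    have sx: "(\<Sum>u\<in>?V. ?a x u) = 1" and sy: "(\<Sum>u\<in>?V. ?a y u) = 1"
      using ker1[OF xyV(1)] ker1[OF xyV(2)] xy irr adj_commute[of G x y]
      by (simp_all add: split)
    have "(\<Sum>u\<in>?V. ?a v u) = ?a v x + ?a v y"
      using ker1[of v] v by (simp add: split)
    then have "(\<Sum>u\<in>?V. of_bool (adj ?H v u) * (1 :: bit)) = 0"
      unfolding sumH[OF v] using sx sy by (auto simp: adj_commute)
    then show "(\<Sum>u\<in>?V. of_bool (adj ?H v u) :: bit) = 0" by simp
  qed
  have **: "f u = f w" if f: "\<forall>v\<in>?V. (\<Sum>u\<in>?V. of_bool (adj ?H v u) * f u) = 0" and "u \<in> ?V" "w \<in> ?V"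
    for f :: "'a \<Rightarrow> bit" and u w
  proof -
    define X where "X = (\<Sum>u\<in>?V. ?a x u * f u)"
    define Y where "Y = (\<Sum>u\<in>?V. ?a y u * f u)"
    \<comment> \<open>The two new values are forced: row \<open>x\<close> of the extended vector
      reads \<open>g y + X = 0\<close>, and row \<open>y\<close> reads
      \<open>g x + Y = 0\<close>.\<close>
    define g where "g = f(x := Y, y := X)"
    have g: "(\<Sum>u\<in>?V. ?a v u * g u) = (\<Sum>u\<in>?V. ?a v u * f u)" for v
      by (intro sum.cong refl) (auto simp: g_def)
    have gxy: "g x = Y" "g y = X" using xyV by (auto simp: g_def)
    have "g u = g w"
    proof (rule ker)
      fix v assume "v \<in> verts G"
      then consider "v = x" | "v = y" | "v \<in> ?V" by auto
      then show "(\<Sum>u\<in>verts G. ?a v u * g u) = 0"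
      proof cases
        case 1
        then show ?thesis unfolding split g gxy using xy irr by (simp add: X_def)
      next
        case 2
        then show ?thesis unfolding split g gxy using xy irr adj_commute[of G x y] by (simp add: Y_def)
      next
        case 3
        then have "(\<Sum>u\<in>?V. ?a v u * f u) + ?a x v * Y + ?a y v * X = 0"
          using f unfolding X_def Y_def sumH[OF 3, symmetric] by (rule bspec[rotated])
        then show ?thesis unfolding split g gxy
          by (auto simp add: adj_commute[of G v])
      qed
    qed (use that in auto)
    then show ?thesis using that by (auto simp: g_def)
  qed
  have "finite_graph ?H"
    unfolding finite_graph_def using finV by (auto simp: gcds_def)
  with * ** show ?thesis unfolding corank_one_def by auto
qed

text \<open>An isolated vertex of the master list would be the only vertex left, hence the only one
  in the list, and then the exception in \<open>gcds2\<close> spares it.\<close>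

lemma gcds2_corank_one:
  assumes G: "corank_one G" and xy: "adj G x y"
  shows "gcds2 G {x, y} = (verts G - {x, y}, edges (gcds G {x, y}))"
proof -
  let ?H = "(verts G - {x, y}, edges (gcds G {x, y}))"
  have fin: "finite_graph G" using G by (rule corank_one_finite)
  have ml: "master_list G {x, y} \<subseteq> verts G - {x, y}"
    using adjD[OF fin] adj_commute[of G]
    by (auto simp: master_list_def column_def neighbors_def adj_def)
  have "master_list G {x, y} = {v}" if "v \<in> master_list G {x, y}" "neighbors (gcds G {x, y}) v = {}" for v
  proof -
    have "verts ?H = {v}"
      using corank_one_isolated[OF corank_one_gcds[OF G xy], of v] that ml
      by (auto simp: neighbors_def)
    with that ml show ?thesis by auto
  qed
  then show ?thesis by (auto simp: gcds2_def)
qed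

lemma corank_one_gcds2:
  assumes "corank_one G" "adj G x y"
  shows "corank_one (gcds2 G {x, y})" "verts (gcds2 G {x, y}) = verts G - {x, y}"
  using corank_one_gcds[OF assms] by (simp_all add: gcds2_corank_one[OF assms])

lemma adj_gcds2:
  assumes "corank_one G" "adj G x y" "p \<in> verts G - {x, y}" "q \<in> verts G - {x, y}"
  shows "adj (gcds2 G {x, y}) p q \<longleftrightarrow> pivot (adj G) x y p q"
  using adj_gcds[OF corank_one_finite[OF assms(1)] assms(2-4)] gcds2_corank_one[OF assms(1,2)]
  by (simp add: adj_def)

lemma card_gcds2:
  assumes "corank_one G" "adj G x y"
  shows "card (verts (gcds2 G {x, y})) = card (verts G) - 2"
proof -
  have "finite_graph G" using assms(1) by (rule corank_one_finite)
  from adjD[OF this assms(2)] show ?thesis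
    by (simp add: corank_one_gcds2[OF assms] card_Diff_subset)
qed

section \<open>The final move, and the win of TWO when moving last\<close>

lemma corank_one_nbr:
  assumes "corank_one G" "card (verts G) > 1" "v \<in> verts G"
  obtains u where "adj G v u"
proof -
  have "neighbors G v \<noteq> {}"
    using corank_one_isolated[OF assms(1,3)] assms(2) by auto
  with that show ?thesis by (auto simp: neighbors_def adj_def)
qed

lemma singleton_no_edges:
  assumes "finite_graph G" "verts G = {v}"
  shows "edges G = {}"
proof -
  have False if e: "e \<in> edges G" for e
  proof -
    obtain p q where "adj G p q" using edgeE[OF assms(1) e] .
    from adjD[OF assms(1) this] assms(2) show False by simp
  qed
  then show ?thesis by blast
qed

text \<open>A vertex \<open>a\<close> other than \<open>v\<close> has a neighbor and even degree, so
  it is adjacent to both other vertices. Playing \<open>a\<close> with the third vertex leaves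
  \<open>v\<close>.\<close>

lemma corank_one_triangle:
  assumes G: "corank_one G" and c: "card (verts G) = 3" and v: "v \<in> verts G"
  obtains e where "e \<in> edges G" "gcds2 G e = ({v}, {})"
proof -
  have fin: "finite_graph G" using G by (rule corank_one_finite)
  obtain a b where V: "verts G = {v, a, b}" "v \<noteq> a" "v \<noteq> b" "a \<noteq> b"
  proof -
    have "card (verts G - {v}) = 2" using c v by simp
    then obtain a b where "verts G - {v} = {a, b}" "a \<noteq> b" by (auto simp: card_2_iff)
    with that[of a b] v show ?thesis by blast
  qed
  obtain u where u: "adj G a u" using corank_one_nbr[OF G, of a] c V by auto
  have na: "\<not> adj G a a" and "u \<in> verts G" using adjD[OF fin] u by blast+
  have "(\<Sum>u\<in>{v, a, b}. of_bool (adj G a u) :: bit) = 0"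
    using G V unfolding corank_one_def by (metis insertI1 insertI2)
  then have "adj G a v = adj G a b"
    using na V by (simp add: of_bool_def split: if_splits)
  moreover have "u = v \<or> u = b" using \<open>u \<in> verts G\<close> na u V by auto
  ultimately have ab: "adj G a b" using u by auto
  have "verts (gcds2 G {a, b}) = {v}" using corank_one_gcds2[OF G ab] V by auto
  moreover from this have "edges (gcds2 G {a, b}) = {}"
    by (rule singleton_no_edges[OF corank_one_finite[OF corank_one_gcds2(1)[OF G ab]]])
  ultimately show ?thesis using that[of "{a, b}"] ab by (simp add: adj_def prod_eq_iff)
qed

lemma forces_triangle:
  assumes "corank_one G" "card (verts G) = 3" "v \<in> verts G" "v \<in> B \<longleftrightarrow> p = ONE"
  shows "forces B p p G"
proof -
  obtain e where e: "e \<in> edges G" "gcds2 G e = ({v}, {})"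
    using corank_one_triangle[OF assms(1-3)] .
  have "winner B ({v}, {}) = p"
    using assms(4) by (cases p) (simp_all add: winner_def)
  then have "forces B p (opponent p) (gcds2 G e)"
    unfolding e(2) by (intro forces.final) simp_all
  with e(1) show ?thesis by (rule forces.own)
qed

lemma corank_one_edges_nonempty:
  assumes "corank_one G" "card (verts G) > 1"
  shows "edges G \<noteq> {}"
proof -
  have "verts G \<noteq> {}" using assms(2) by auto
  then obtain v where "v \<in> verts G" by blast
  then show ?thesis using corank_one_nbr[OF assms] by (auto simp: adj_def)
qed

text \<open>The bound allows TWO to reach the final triangle with at most two favorable vertices when removing
  one favorable vertex with each of the earlier moves.\<close>

lemma forces_TWO:
  assumes "corank_one G" "card (verts G) = 2*m + 1" "m \<ge> 1" "q = TWO \<longleftrightarrow> odd m"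
    "card (B \<inter> verts G) \<le> (m + 3) div 2"
  shows "forces B TWO q G"
  using assms
proof (induction m arbitrary: G q)
  case (Suc m)
  have fin: "finite_graph G" "finite (verts G)" 
    using corank_one_finite[OF Suc.prems(1)] by (auto simp: finite_graph_def)
  have IH: "forces B TWO (opponent q) (gcds2 G {x, y})"
    if xy: "adj G x y" and "m \<ge> 1" and c: "card (B \<inter> verts (gcds2 G {x, y})) \<le> (m + 3) div 2" for x y
  proof (rule Suc.IH)
    show "(opponent q = TWO) = odd m" using Suc.prems(4) by (cases q) auto
  qed (use corank_one_gcds2[OF Suc.prems(1) xy] card_gcds2[OF Suc.prems(1) xy] Suc.prems that in auto)
  have mono: "card (B \<inter> verts (gcds2 G {x, y})) \<le> card (B \<inter> verts G)" if "adj G x y" for x y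
    using fin corank_one_gcds2[OF Suc.prems(1) that] by (intro card_mono) auto
  have ne: "edges G \<noteq> {}" using corank_one_edges_nonempty[OF Suc.prems(1)] Suc.prems(2) by simp
  show ?case
  proof (cases "q = TWO")
    case False
    then have q: "q = opponent TWO" by (cases q) auto
    show ?thesis unfolding q
    proof (rule forces.other[OF ne])
      fix e assume "e \<in> edges G"
      then obtain x y where e: "e = {x, y}" "adj G x y" using edgeE[OF fin(1)] by metis
      \<comment> \<open>ONE is to move and \<open>Suc m\<close> is even, so the bound keeps its
        value and nothing has to be removed.\<close>
      have "odd m" using False Suc.prems(4) by simp
      then have "m \<ge> 1" "(Suc m + 3) div 2 = (m + 3) div 2" by presburger+
      then show "forces B TWO TWO (gcds2 G e)"
        using IH[OF e(2)] mono[OF e(2)] Suc.prems(5) q unfolding e by simp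
    qed
  next
    case True
    then have "even m" using Suc.prems(4) by simp
    show ?thesis
    proof (cases "m = 0")
      case True
      \<comment> \<open>At the last move the bound is 2, less than the three vertices
        present.\<close>
      then have "card (B \<inter> verts G) < card (verts G)" using Suc.prems by simp
      then obtain v where "v \<in> verts G" "v \<notin> B" using fin by (metis Int_absorb1 less_irrefl subsetI)
      with forces_triangle[OF Suc.prems(1), of v B TWO] show ?thesis using True \<open>q = TWO\<close> Suc.prems(2) by simp
    next
      case False
      \<comment> \<open>An edge at a favorable vertex exists because no vertex is isolated. If no
        favorable vertex is left, any edge serves.\<close>
      obtain x y where xy: "adj G x y" "x \<in> B \<or> B \<inter> verts G = {}"
      proof (cases "B \<inter> verts G = {}")
        case True
        with ne that show ?thesis using edgeE[OF fin(1)] by (metis ex_in_conv)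
      next
        case False
        then show ?thesis using corank_one_nbr[OF Suc.prems(1)] Suc.prems(2) that by auto
      qed
      have "card (B \<inter> verts (gcds2 G {x, y})) \<le> (m + 3) div 2"
      proof (cases "B \<inter> verts G = {}")
        case True
        then show ?thesis using mono[OF xy(1)] by simp
      next
        case False
        then have "B \<inter> verts (gcds2 G {x, y}) \<subset> B \<inter> verts G"
          using xy corank_one_gcds2[OF Suc.prems(1) xy(1)] adjD[OF fin(1) xy(1)] by auto
        then have "card (B \<inter> verts (gcds2 G {x, y})) < card (B \<inter> verts G)"
          using fin by (intro psubset_card_mono) auto
        \<comment> \<open>For even \<open>m\<close> the bound drops by exactly 1, which the removed
          favorable vertex pays for.\<close>
        then show ?thesis using Suc.prems(5) \<open>even m\<close> by presburger
      qed
      with IH[OF xy(1)] False have "forces B TWO (opponent TWO) (gcds2 G {x, y})"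
        using \<open>q = TWO\<close> by simp
      then show ?thesis unfolding \<open>q = TWO\<close> using xy(1) by (intro forces.own[of "{x, y}"]) (simp_all add: adj_def)
    qed
  qed
qed simp

section \<open>ONE moving last\<close>

text \<open>On positive labels this is the endless chain, so that one relation serves all lengths;
  the length enters only through the range of labels.\<close>

definition chain_adj :: "nat \<Rightarrow> nat \<Rightarrow> bool" where
  "chain_adj j k \<longleftrightarrow> k = j + 1 \<or> j = k + 1 \<or> odd j \<and> k = j + 2 \<or> odd k \<and> j = k + 2"

lemma chain_adj_commute: "chain_adj j k \<longleftrightarrow> chain_adj k j"
  by (auto simp: chain_adj_def)

text \<open>If TWO plays two vertices of the triangle \<open>{2i-1, 2i, 2i+1}\<close> and \<open>r\<close> is its third vertex, ONE answers
  with \<open>{r, 2i-2}\<close> for \<open>i \<ge> 3\<close>, with \<open>{r, 6}\<close> for \<open>i = 2\<close>, and with \<open>{5, 6}\<close> for \<open>i = 1\<close>. In all cases the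
  remaining vertices, in increasing order, form a chain again. The functions \<open>skip4\<close> and \<open>skip_first\<close>
  map the new labels to the old ones, preserving divisibility by 4.\<close>

definition skip4 :: "nat \<Rightarrow> nat \<Rightarrow> nat" where
  "skip4 d k = (if k < d then k else k + 4)"

text \<open>Here \<open>d = 2*i - 2\<close>. Among the survivors, \<open>d\<close>, ...,
  \<open>d + 3\<close> meet only \<open>d - 1\<close>, \<open>d + 4\<close> and
  \<open>d + 5\<close>. The two pivots join \<open>d - 1\<close> to \<open>d + 4\<close> and
  \<open>d + 5\<close>, so that it takes the place of \<open>d + 3\<close>.\<close>

lemma chain_pivots_far:
  assumes d: "even d" "d \<ge> 4"
    and xyr: "(x, y, r) \<in> {(d + 1, d + 2, d + 3), (d + 2, d + 3, d + 1), (d + 1, d + 3, d + 2)}"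
  shows "pivot (pivot chain_adj x y) r d (skip4 d j) (skip4 d k) \<longleftrightarrow> chain_adj j k"
proof -
  have nb: "chain_adj d (skip4 d k) \<longleftrightarrow> k = d - 1" "chain_adj (d + 1) (skip4 d k) \<longleftrightarrow> k = d - 1"
    "\<not> chain_adj (d + 2) (skip4 d k)" "chain_adj (d + 3) (skip4 d k) \<longleftrightarrow> k = d \<or> k = d + 1" for k
    using d unfolding chain_adj_def skip4_def by presburger+
  have nb': "chain_adj (skip4 d k) d \<longleftrightarrow> k = d - 1" for k
    using d unfolding chain_adj_def skip4_def by presburger
  have dd: "chain_adj (d + 1) d" "\<not> chain_adj (d + 2) d" "\<not> chain_adj (d + 3) d" 
    "chain_adj (d + 1) (d + 2)" "chain_adj (d + 1) (d + 3)" "chain_adj (d + 2) (d + 3)"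
    "chain_adj (d + 2) (d + 1)" "chain_adj (d + 3) (d + 1)" "chain_adj (d + 3) (d + 2)"
    using d unfolding chain_adj_def by presburger+
  have far: "\<not> chain_adj j (k + 4)" "chain_adj j k \<longleftrightarrow> j = d - 1 \<and> (k = d \<or> k = d + 1)" "k \<noteq> d - 1"
    if "j < d" "d \<le> k" for j k
    using d that unfolding chain_adj_def by presburger+
  \<comment> \<open>The new adjacency is the old one, flipped at the seam. Once all adjacencies are
    expressed by equations with \<open>d - 1\<close>, \<open>d\<close> and \<open>d + 1\<close>, the
    claim is propositional.\<close>
  have pq: "chain_adj j k \<longleftrightarrow> (chain_adj (skip4 d j) (skip4 d k) \<noteq>
      (j = d - 1 \<and> (k = d \<or> k = d + 1))) \<noteq> (k = d - 1 \<and> (j = d \<or> j = d + 1))"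
  proof (cases "j < d"; cases "k < d")
    assume "j < d" "k < d"
    then show ?thesis by (auto simp: skip4_def)
  next
    assume "j < d" "\<not> k < d"
    then show ?thesis using far[of j k] by (auto simp: skip4_def)
  next
    assume "\<not> j < d" "k < d"
    then show ?thesis using far[of k j] by (auto simp: skip4_def chain_adj_commute[of j] chain_adj_commute[of "j + 4"])
  next
    assume "\<not> j < d" "\<not> k < d"
    then have "j \<noteq> d - 1" "k \<noteq> d - 1" using d by auto
    moreover have "chain_adj (j + 4) (k + 4) \<longleftrightarrow> chain_adj j k" by (auto simp: chain_adj_def)
    ultimately show ?thesis using \<open>\<not> j < d\<close> \<open>\<not> k < d\<close> by (simp add: skip4_def)
  qed
  have ne: "k = d - 1 \<Longrightarrow> k \<noteq> d \<and> k \<noteq> d + 1" for k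
    using d by auto
  from xyr consider "x = d + 1" "y = d + 2" "r = d + 3" | "x = d + 2" "y = d + 3" "r = d + 1"
    | "x = d + 1" "y = d + 3" "r = d + 2"
    by auto
  then show ?thesis
  proof cases
    case 1
    show ?thesis unfolding 1 pq pivot_def nb nb' using ne[of j] ne[of k] nb(3)[of j] nb(3)[of k] dd by satx
  next
    case 2
    show ?thesis unfolding 2 pq pivot_def nb nb' using ne[of j] ne[of k] nb(3)[of j] nb(3)[of k] dd by satx
  next
    case 3
    show ?thesis unfolding 3 pq pivot_def nb nb' using ne[of j] ne[of k] nb(3)[of j] nb(3)[of k] dd by satx
  qed
qed

lemma iff_iff_cancel: "((P \<longleftrightarrow> Q) \<longleftrightarrow> Q) \<longleftrightarrow> P"
  by blast

text \<open>The reply of the later triangles would use up the favorable vertex \<open>2\<close>.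
  Playing \<open>6\<close> keeps it, and \<open>7\<close> takes the place of
  \<open>3\<close>.\<close>

lemma chain_pivots_second:
  assumes xyr: "(x, y, r) \<in> {(3, 4, 5), (4, 5, 3), (3, 5, 4)}" and jk: "j \<ge> 1" "k \<ge> 1"
  shows "pivot (pivot chain_adj x y) r 6 (skip4 3 j) (skip4 3 k) \<longleftrightarrow> chain_adj j k"
proof -
  have c: "j = 1 \<or> j = 2 \<or> (\<exists>m. j = m + 3)" if "j \<ge> 1" for j :: nat
    using that by presburger
  show ?thesis
    using xyr c[OF jk(1)] c[OF jk(2)] 
    by (elim disjE exE insertE emptyE) (simp_all add: pivot_def skip4_def chain_adj_def iff_iff_cancel)
qed

definition skip_first :: "nat \<Rightarrow> nat \<Rightarrow> nat" where
  "skip_first r k = (if k = 1 then r else if k = 2 then 4 else k + 4)"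

text \<open>The survivors \<open>r\<close>, \<open>4\<close> and \<open>7\<close> become the first
  triangle, with the favorable \<open>4\<close> in the role of \<open>2\<close>.\<close>

lemma chain_pivots_first:
  assumes xyr: "(x, y, r) \<in> {(1, 2, 3), (2, 3, 1), (1, 3, 2)}" and jk: "j \<ge> 1" "k \<ge> 1"
  shows "pivot (pivot chain_adj x y) 5 6 (skip_first r j) (skip_first r k) \<longleftrightarrow> chain_adj j k"
proof -
  have c: "j = 1 \<or> j = 2 \<or> (\<exists>m. j = m + 3)" if "j \<ge> 1" for j :: nat
    using that by presburger
  show ?thesis
    using xyr c[OF jk(1)] c[OF jk(2)] 
    by (elim disjE exE insertE emptyE) (simp_all add: pivot_def skip_first_def chain_adj_def iff_iff_cancel)
qed

section \<open>Transport of labels and the replies of ONE\<close>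

text \<open>Arbitrary index sets let a move delete two labels without renumbering;
  \<open>labelled_relabel\<close> renumbers afterwards.\<close>

definition labelled :: "'a graph \<Rightarrow> (nat \<Rightarrow> 'a) \<Rightarrow> nat set \<Rightarrow> (nat \<Rightarrow> nat \<Rightarrow> bool) \<Rightarrow> bool" where
  "labelled G l I r \<longleftrightarrow> corank_one G \<and> bij_betw l I (verts G) \<and>
     (\<forall>j\<in>I. \<forall>k\<in>I. adj G (l j) (l k) \<longleftrightarrow> r j k)"

lemma labelled_gcds2:
  assumes l: "labelled G l I r" and jk: "j \<in> I" "k \<in> I" "r j k"
  shows "labelled (gcds2 G {l j, l k}) l (I - {j, k}) (pivot r j k)"
proof -
  have G: "corank_one G" and bij: "bij_betw l I (verts G)"
    and r: "\<And>j k. j \<in> I \<Longrightarrow> k \<in> I \<Longrightarrow> adj G (l j) (l k) \<longleftrightarrow> r j k"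
    using l unfolding labelled_def by blast+
  have a: "adj G (l j) (l k)" using r jk by blast
  have eq: "l p = l q \<longleftrightarrow> p = q" if "p \<in> I" "q \<in> I" for p q
    using bij that by (auto simp: bij_betw_def inj_on_def)
  have in_verts: "l p \<in> verts G - {l j, l k}" if "p \<in> I - {j, k}" for p
    using that jk bij by (auto simp: eq bij_betw_def)
  have "bij_betw l (I - {j, k}) (verts (gcds2 G {l j, l k}))"
    unfolding corank_one_gcds2(2)[OF G a]
    using jk bij eq by (auto simp: bij_betw_def inj_on_def)
  moreover have "adj (gcds2 G {l j, l k}) (l p) (l q) \<longleftrightarrow> pivot r j k p q"
    if "p \<in> I - {j, k}" "q \<in> I - {j, k}" for p q
    using adj_gcds2[OF G a in_verts[OF that(1)] in_verts[OF that(2)]] that jk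
    by (simp add: pivot_def r)
  ultimately show ?thesis
    using corank_one_gcds2(1)[OF G a] unfolding labelled_def by blast
qed

lemma labelled_relabel:
  assumes "labelled G l I r" "bij_betw s J I"
    "\<And>j k. j \<in> J \<Longrightarrow> k \<in> J \<Longrightarrow> r (s j) (s k) \<longleftrightarrow> r' j k"
  shows "labelled G (l \<circ> s) J r'"
proof -
  have "s j \<in> I" if "j \<in> J" for j using assms(2) that by (auto simp: bij_betw_def)
  then show ?thesis
    using assms(1,3) bij_betw_trans[OF assms(2), of l "verts G"] unfolding labelled_def by simp
qed

abbreviation labelled_chain :: "'a graph \<Rightarrow> (nat \<Rightarrow> 'a) \<Rightarrow> nat \<Rightarrow> bool" where
  "labelled_chain G l n \<equiv> labelled G l {1..2*n + 1} chain_adj"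

lemma labelled_chain_two_moves:
  assumes G: "labelled_chain G l n"
    and xy: "x \<in> {1..2*n + 1}" "y \<in> {1..2*n + 1}" "chain_adj x y"
    and zw: "z \<in> {1..2*n + 1} - {x, y}" "w \<in> {1..2*n + 1} - {x, y}" "pivot chain_adj x y z w"
    and s: "bij_betw s {1..2*m + 1} ({1..2*n + 1} - {x, y} - {z, w})"
    and eq: "\<And>j k. j \<ge> 1 \<Longrightarrow> k \<ge> 1 \<Longrightarrow> pivot (pivot chain_adj x y) z w (s j) (s k) \<longleftrightarrow> chain_adj j k"
  shows "{l z, l w} \<in> edges (gcds2 G {l x, l y})"
    "labelled_chain (gcds2 (gcds2 G {l x, l y}) {l z, l w}) (l \<circ> s) m"
proof -
  note 1 = labelled_gcds2[OF G xy]
  show "{l z, l w} \<in> edges (gcds2 G {l x, l y})"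
    using 1 zw unfolding labelled_def adj_def[symmetric] by blast
  show "labelled_chain (gcds2 (gcds2 G {l x, l y}) {l z, l w}) (l \<circ> s) m"
    using labelled_gcds2[OF 1 zw] by (rule labelled_relabel[OF _ s]) (simp add: eq)
qed

lemma bij_skip4:
  assumes "1 \<le> d" "d + 2 \<le> 2*n" "2 \<le> n"
  shows "bij_betw (skip4 d) {1..2*(n - 2) + 1} ({1..2*n + 1} - {d, d + 1, d + 2, d + 3})"
  using assms
  by (intro bij_betw_byWitness[where f' = "\<lambda>k. if k < d then k else k - 4"]) (auto simp: skip4_def)

lemma bij_skip_first:
  assumes "r \<in> {1, 2, 3}" "3 \<le> n"
  shows "bij_betw (skip_first r) {1..2*(n - 2) + 1} ({1..2*n + 1} - ({1, 2, 3} - {r}) - {5, 6})"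
  using assms
  by (intro bij_betw_byWitness[where f' = "\<lambda>k. if k = r then 1 else if k = 4 then 2 else k - 4"])
    (auto simp: skip_first_def)

text \<open>An odd \<open>x\<close> is the lowest vertex of the triangle, so
  \<open>d = x - 1\<close>. For even \<open>x\<close> the edge is \<open>{x, x + 1}\<close>, the
  third vertex is \<open>x - 1\<close>, and \<open>d = x - 2\<close>.\<close>

lemma chain_adj_triangle:
  assumes "chain_adj x y" "x < y" "x \<ge> 1" "y \<le> 2*n + 1"
  obtains d r where "even d" "d + 2 \<le> 2*n"
    "(x, y, r) \<in> {(d + 1, d + 2, d + 3), (d + 2, d + 3, d + 1), (d + 1, d + 3, d + 2)}"
proof (cases "odd x")
  case True
  then obtain b where b: "x = 2*b + 1" by (elim oddE)
  with assms consider "y = 2*b + 2" "b + 1 \<le> n" | "y = 2*b + 3" "b + 1 \<le> n"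
    unfolding chain_adj_def by force
  then show ?thesis
    using b by cases (auto intro: that[of "2*b" "2*b + 3"] that[of "2*b" "2*b + 2"])
next
  case False
  with assms have "y = x + 1" by (auto simp: chain_adj_def)
  with False assms show ?thesis
    by (intro that[of "x - 2" "x - 1"]) (auto elim!: evenE)
qed

lemma favorable_eq: "favorable n = insert 2 {k \<in> {1..2*n + 1}. k mod 4 = 0}"
  by (simp add: favorable_def verts_triangle_chain)

lemma favorable_skip4:
  assumes "d \<ge> 3" "n \<ge> 2"
  shows "skip4 d ` favorable (n - 2) \<subseteq> favorable n"
proof (rule image_subsetI)
  fix k assume "k \<in> favorable (n - 2)"
  then have "k = 2 \<or> 1 \<le> k \<and> k + 4 \<le> 2*n + 1 \<and> k mod 4 = 0"
    using assms(2) by (auto simp: favorable_eq)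
  with assms(1) show "skip4 d k \<in> favorable n"
    by (auto simp: favorable_eq skip4_def)
qed

text \<open>The label 2 goes to 4 and multiples of 4 rise by 4. The label 1 is not favorable, so
  \<open>r\<close> may be any vertex.\<close>

lemma favorable_skip_first:
  assumes "n \<ge> 3"
  shows "skip_first r ` favorable (n - 2) \<subseteq> favorable n"
proof (rule image_subsetI)
  fix k assume "k \<in> favorable (n - 2)"
  then have "k = 2 \<or> 1 \<le> k \<and> k + 4 \<le> 2*n + 1 \<and> k mod 4 = 0"
    using assms by (auto simp: favorable_eq)
  with assms show "skip_first r k \<in> favorable n"
    by (auto simp: favorable_eq skip_first_def)
qed

lemma chain_reply:
  assumes G: "labelled_chain G l n" and n: "n \<ge> 3"
    and xy: "chain_adj x y" "x < y" "x \<ge> 1" "y \<le> 2*n + 1"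
  obtains e s where "e \<in> edges (gcds2 G {l x, l y})"
    "labelled_chain (gcds2 (gcds2 G {l x, l y}) e) (l \<circ> s) (n - 2)"
    "s ` favorable (n - 2) \<subseteq> favorable n"
proof -
  obtain d r where d: "even d" "d + 2 \<le> 2*n"
    and r: "(x, y, r) \<in> {(d + 1, d + 2, d + 3), (d + 2, d + 3, d + 1), (d + 1, d + 3, d + 2)}"
    using chain_adj_triangle[OF xy] .
  have xy': "x \<in> {1..2*n + 1}" "y \<in> {1..2*n + 1}" using xy by auto
  note two = labelled_chain_two_moves[OF G xy' xy(1)]
  \<comment> \<open>These are the first, second and later triangles; \<open>n \<ge> 3\<close>
    supplies the vertex \<open>6\<close> for the first two cases.\<close>
  have "d = 0 \<or> d = 2 \<or> d \<ge> 4" using d(1) by presburger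
  then consider "d = 0" | "d = 2" | "d \<ge> 4" by blast
  then show ?thesis
  proof cases
    case 1
    have r: "(x, y, r) \<in> {(1, 2, 3), (2, 3, 1), (1, 3, 2)}" using r unfolding 1 by (simp add: numeral_2_eq_2)
    have "{1..2*n + 1} - ({1, 2, 3} - {r}) - {5, 6} = {1..2*n + 1} - {x, y} - {5, 6}"
      using r by auto
    then have bij: "bij_betw (skip_first r) {1..2*(n - 2) + 1} ({1..2*n + 1} - {x, y} - {5, 6})"
      using bij_skip_first[of r n] r n by auto
    have zw: "5 \<in> {1..2*n + 1} - {x, y}" "6 \<in> {1..2*n + 1} - {x, y}"
      using r n by auto
    have piv: "pivot chain_adj x y 5 6"
      using r by (elim insertE emptyE) (simp_all add: pivot_def chain_adj_def)
    have fav: "skip_first r ` favorable (n - 2) \<subseteq> favorable n"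
      using n by (intro favorable_skip_first) auto
    show ?thesis
      by (rule that[OF two(1)[OF zw piv bij] two(2)[OF zw piv bij] fav])
        (use chain_pivots_first[OF r] in auto)
  next
    case 2
    have r: "(x, y, r) \<in> {(3, 4, 5), (4, 5, 3), (3, 5, 4)}" using r unfolding 2 by simp
    have "{1..2*n + 1} - {3, 3 + 1, 3 + 2, 3 + 3} = {1..2*n + 1} - {x, y} - {r, 6}"
      using r by auto
    then have bij: "bij_betw (skip4 3) {1..2*(n - 2) + 1} ({1..2*n + 1} - {x, y} - {r, 6})"
      using bij_skip4[of 3 n] n by simp
    have zw: "r \<in> {1..2*n + 1} - {x, y}" "6 \<in> {1..2*n + 1} - {x, y}"
      using r n by auto
    have piv: "pivot chain_adj x y r 6"
      using r by (elim insertE emptyE) (simp_all add: pivot_def chain_adj_def)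
    have fav: "skip4 3 ` favorable (n - 2) \<subseteq> favorable n"
      using n by (intro favorable_skip4) auto
    show ?thesis
      by (rule that[OF two(1)[OF zw piv bij] two(2)[OF zw piv bij] fav])
        (use chain_pivots_second[OF r] in auto)
  next
    case 3
    have "{1..2*n + 1} - {d, d + 1, d + 2, d + 3} = {1..2*n + 1} - {x, y} - {r, d}"
      using r by auto
    then have bij: "bij_betw (skip4 d) {1..2*(n - 2) + 1} ({1..2*n + 1} - {x, y} - {r, d})"
      using bij_skip4[of d n] n d 3 by simp
    have zw: "r \<in> {1..2*n + 1} - {x, y}" "d \<in> {1..2*n + 1} - {x, y}"
      using r n d 3 by auto
    have piv: "pivot chain_adj x y r d"
      using r d(1) 3 by (elim insertE emptyE) (simp_all add: pivot_def chain_adj_def)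
    have fav: "skip4 d ` favorable (n - 2) \<subseteq> favorable n"
      using n 3 by (intro favorable_skip4) auto
    show ?thesis
      by (rule that[OF two(1)[OF zw piv bij] two(2)[OF zw piv bij] fav])
        (use chain_pivots_far[OF d(1) 3 r] in auto)
  qed
qed

lemma card_labelled_chain:
  assumes "labelled_chain G l n"
  shows "card (verts G) = 2*n + 1"
  using assms bij_betw_same_card[of l "{1..2*n + 1}"] unfolding labelled_def by fastforce

lemma labelled_chain_edge:
  assumes G: "labelled_chain G l n" and e: "e \<in> edges G"
  obtains x y where "e = {l x, l y}" "chain_adj x y" "x < y" "x \<ge> 1" "y \<le> 2*n + 1"
proof -
  have c: "corank_one G" and bij: "bij_betw l {1..2*n + 1} (verts G)"
    and r: "\<And>j k. j \<in> {1..2*n + 1} \<Longrightarrow> k \<in> {1..2*n + 1} \<Longrightarrow> adj G (l j) (l k) \<longleftrightarrow> chain_adj j k"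
    using G unfolding labelled_def by blast+
  obtain u v where uv: "e = {u, v}" "adj G u v" using edgeE[OF corank_one_finite[OF c] e] .
  then have "u \<in> l ` {1..2*n + 1}" "v \<in> l ` {1..2*n + 1}"
    using adjD[OF corank_one_finite[OF c]] bij unfolding bij_betw_def by metis+
  then obtain x y where x: "x \<in> {1..2*n + 1}" "u = l x" and y: "y \<in> {1..2*n + 1}" "v = l y" by blast
  then have a: "chain_adj x y" using r uv by blast
  then have "x < y \<or> y < x" by (auto simp: chain_adj_def)
  then show ?thesis
    using that[of x y] that[of y x] x y a uv(1) by (auto simp: chain_adj_commute insert_commute)
qed

text \<open>Induction in steps of two, a round being a move of TWO and the reply of ONE. An
  inclusion in \<open>B\<close> suffices, since further favorable vertices only help ONE.\<close>

lemma forces_ONE_even: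
  assumes "even n" "n \<ge> 2" "labelled_chain G l n" "l ` favorable n \<subseteq> B"
  shows "forces B ONE TWO G"
  using assms
proof (induction n arbitrary: G l rule: less_induct)
  case (less n)
  have c: "corank_one G" and bij: "bij_betw l {1..2*n + 1} (verts G)"
    using less.prems(3) unfolding labelled_def by blast+
  have "edges G \<noteq> {}"
    using corank_one_edges_nonempty[OF c] card_labelled_chain[OF less.prems(3)] less.prems(2) by simp
  moreover have "forces B ONE ONE (gcds2 G e)" if edge: "e \<in> edges G" for e
  proof -
    obtain x y where e: "e = {l x, l y}" and xy: "chain_adj x y" "x < y" "x \<ge> 1" "y \<le> 2*n + 1"
      using labelled_chain_edge[OF less.prems(3) edge] .
    show ?thesis
    proof (cases "n = 2")
      case True
      \<comment> \<open>The favorable vertices \<open>2\<close> and \<open>4\<close> are not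
        adjacent, so TWO cannot remove both, and ONE keeps the survivor with the last move.\<close>
      obtain k where k: "k = 2 \<or> k = 4" "k \<noteq> x" "k \<noteq> y"
      proof (cases "2 \<in> {x, y}")
        case True
        then have "x = 2 \<or> y = 2" by blast
        with xy have "4 \<noteq> x" "4 \<noteq> y" unfolding chain_adj_def by presburger+
        with that[of 4] show ?thesis by blast
      next
        case False
        with that[of 2] show ?thesis by blast
      qed
      have a: "adj G (l x) (l y)" using edge unfolding e adj_def .
      have "l k \<in> verts G - {l x, l y}"
        using bij k xy True by (auto simp: bij_betw_def inj_on_def)
      moreover have "l k \<in> B" using less.prems(4) k True by (auto simp: favorable_eq)
      ultimately show ?thesis unfolding e
        using corank_one_gcds2[OF c a] card_gcds2[OF c a] card_labelled_chain[OF less.prems(3)] True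
        by (intro forces_triangle[of _ "l k"]) auto
    next
      case False
      with less.prems(1,2) have n: "n \<ge> 4" by presburger
      obtain e' s where e': "e' \<in> edges (gcds2 G e)"
        and ch: "labelled_chain (gcds2 (gcds2 G e) e') (l \<circ> s) (n - 2)"
        and s: "s ` favorable (n - 2) \<subseteq> favorable n"
        using chain_reply[OF less.prems(3) _ xy] n unfolding e by auto
      have "(l \<circ> s) ` favorable (n - 2) \<subseteq> B" using s less.prems(4) by (auto simp: image_subset_iff)
      then have "forces B ONE TWO (gcds2 (gcds2 G e) e')"
        using less.prems(1) n by (intro less.IH[OF _ _ _ ch]) auto
      then show ?thesis using e' by (intro forces.own[of e']) simp_all
    qed
  qed
  ultimately have "forces B ONE (opponent ONE) G" by (rule forces.other)
  then show ?case by simp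
qed

text \<open>ONE opens with the two last vertices, which leaves the chain with one triangle less and
  TWO to move. A single triangle is decided at once.\<close>

lemma forces_ONE_odd:
  assumes "odd n" "labelled_chain G l n" "l ` favorable n \<subseteq> B"
  shows "forces B ONE ONE G"
proof -
  have c: "corank_one G" and bij: "bij_betw l {1..2*n + 1} (verts G)"
    and r: "\<And>j k. j \<in> {1..2*n + 1} \<Longrightarrow> k \<in> {1..2*n + 1} \<Longrightarrow> adj G (l j) (l k) \<longleftrightarrow> chain_adj j k"
    using assms(2) unfolding labelled_def by blast+
  show ?thesis
  proof (cases "n = 1")
    case True
    have "l 2 \<in> verts G" using bij True by (auto simp: bij_betw_def)
    moreover have "l 2 \<in> B" using assms(3) by (auto simp: favorable_eq)
    ultimately show ?thesis using c card_labelled_chain[OF assms(2)] True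
      by (intro forces_triangle[of _ "l 2"]) auto
  next
    case False
    with assms(1) have n: "n \<ge> 3" by presburger
    have e: "chain_adj (2*n) (2*n + 1)" "2*n \<in> {1..2*n + 1}" "2*n + 1 \<in> {1..2*n + 1}"
      using n by (auto simp: chain_adj_def)
    have "{1..2*(n - 1) + 1} = {1..2*n + 1} - {2*n, 2*n + 1}" using n by auto
    then have I: "bij_betw id {1..2*(n - 1) + 1} ({1..2*n + 1} - {2*n, 2*n + 1})"
      by (metis bij_betw_id)
    have "labelled_chain (gcds2 G {l (2*n), l (2*n + 1)}) (l \<circ> id) (n - 1)"
    proof (rule labelled_relabel[OF labelled_gcds2[OF assms(2) e(2,3,1)] I])
      fix j k assume jk: "j \<in> {1..2*(n - 1) + 1}" "k \<in> {1..2*(n - 1) + 1}"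
      \<comment> \<open>Both removed vertices have \<open>2*n - 1\<close> as their only surviving
        neighbor, so the two products in \<open>pivot\<close> agree and cancel.\<close>
      have "chain_adj (2*n) j \<longleftrightarrow> j = 2*n - 1" if "j \<in> {1..2*(n - 1) + 1}" for j
        using that n by (auto simp: chain_adj_def) presburger
      moreover have "chain_adj (2*n + 1) j \<longleftrightarrow> j = 2*n - 1" if "j \<in> {1..2*(n - 1) + 1}" for j
        using that n by (auto simp: chain_adj_def)
      ultimately show "pivot chain_adj (2*n) (2*n + 1) (id j) (id k) \<longleftrightarrow> chain_adj j k"
        using jk by (auto simp: pivot_def)
    qed
    moreover have "favorable (n - 1) \<subseteq> favorable n" by (auto simp: favorable_eq)
    then have "(l \<circ> id) ` favorable (n - 1) \<subseteq> B" using assms(3) by auto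
    ultimately have "forces B ONE TWO (gcds2 G {l (2*n), l (2*n + 1)})"
      using n assms(1) by (intro forces_ONE_even[of "n - 1"]) auto
    then show ?thesis using r[OF e(2,3)] e(1)
      by (intro forces.own[of "{l (2*n), l (2*n + 1)}"]) (auto simp: adj_def)
  qed
qed

section \<open>Adjacency and corank of the chain of triangles\<close>

lemma edge_triangle_chain:
  "{j, k} \<in> edges (triangle_chain n) \<longleftrightarrow> j \<in> {1..2*n + 1} \<and> k \<in> {1..2*n + 1} \<and> chain_adj j k"
proof (induction n)
  case 0
  then show ?case by (auto simp: chain_adj_def)
next
  case (Suc n)
  have ends: "j = 2*n + 1 \<and> k = 2*n + 2 \<or> j = 2*n + 1 \<and> k = 2*n + 3 \<or> j = 2*n + 2 \<and> k = 2*n + 3"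
    if "chain_adj j k" "j < k" "2*n + 1 < k" "k \<le> 2*n + 3" for j k
    using that unfolding chain_adj_def by presburger
  define T where "T = {{2*n + 1, 2*n + 2}, {2*n + 1, 2*n + 3}, {2*n + 2, 2*n + 3}}"
  have "{j, k} \<in> T"
    if jk: "j \<le> 2*n + 3" "k \<le> 2*n + 3" "chain_adj j k" "\<not> (j \<le> 2*n + 1 \<and> k \<le> 2*n + 1)"
  proof (cases "j < k")
    case True
    have "2*n + 1 < k" using jk(4) True by linarith
    from ends[OF jk(3) True this jk(2)] show ?thesis by (elim disjE conjE) (simp_all add: T_def)
  next
    case False
    moreover have "j \<noteq> k" using jk(3) by (auto simp: chain_adj_def)
    ultimately have "k < j" "2*n + 1 < j" using jk(4) by linarith+
    from ends[OF jk(3)[unfolded chain_adj_commute[of j]] this jk(1)] show ?thesis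
      by (elim disjE conjE) (simp_all add: T_def insert_commute)
  qed
  moreover have "chain_adj j k \<and> 1 \<le> j \<and> j \<le> 2*n + 3 \<and> 1 \<le> k \<and> k \<le> 2*n + 3" if "{j, k} \<in> T"
    using that unfolding T_def insert_iff empty_iff doubleton_eq_iff
    by (elim disjE conjE FalseE) (simp_all add: chain_adj_def)
  moreover have "i \<le> 2*n + 1 \<Longrightarrow> i \<le> 2*n + 3" for i by simp
  moreover have "2*Suc n + 1 = 2*n + 3" by simp
  ultimately show ?case
    unfolding triangle_chain.simps snd_conv Un_iff Suc.IH T_def[symmetric] atLeastAtMost_iff by metis
qed

lemma sum_of_bool_mult_restrict:
  fixes g :: "'b \<Rightarrow> 'c::semiring_1"
  assumes "finite A" "N \<subseteq> A" "\<And>k. k \<in> A \<Longrightarrow> P k \<longleftrightarrow> k \<in> N"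
  shows "(\<Sum>k\<in>A. of_bool (P k) * g k) = sum g N"
proof -
  have "(\<Sum>k\<in>A. of_bool (P k) * g k) = (\<Sum>k\<in>N. of_bool (P k) * g k)"
    using assms by (intro sum.mono_neutral_right) auto
  also have "\<dots> = sum g N"
    using assms(2,3) by (intro sum.cong refl) auto
  finally show ?thesis .
qed

lemma chain_index_cases:
  fixes j n :: nat
  assumes "j \<in> {1..2*n + 1}"
  obtains "j = 1" | i where "j = 2*i + 2" "i < n" | i where "j = 2*i + 3" "i < n"
proof (cases "even j")
  case True
  then obtain b where "j = 2*b" by (elim evenE)
  with assms that(2)[of "b - 1"] show ?thesis by (cases b) auto
next
  case False
  then obtain b where "j = 2*b + 1" by (elim oddE)
  with assms that(1) that(3)[of "b - 1"] show ?thesis by (cases b) auto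
qed

text \<open>Every row has 0, 2 or 4 ones, so the constants lie in the kernel. Conversely, the even
  rows make a kernel vector constant on odd labels, row 1 fixes its value at 2, and the inner odd
  rows carry this value from each even label to the next.\<close>

lemma labelled_chainI:
  assumes fin: "finite_graph G" and bij: "bij_betw l {1..2*n + 1} (verts G)"
    and r: "\<And>j k. j \<in> {1..2*n + 1} \<Longrightarrow> k \<in> {1..2*n + 1} \<Longrightarrow> adj G (l j) (l k) \<longleftrightarrow> chain_adj j k"
  shows "labelled_chain G l n"
proof -
  let ?I = "{1..2*n + 1}"
  have row: "(\<Sum>u\<in>verts G. of_bool (adj G (l j) u) * f u) = sum (f \<circ> l) N"
    if "j \<in> ?I" "N \<subseteq> ?I" "\<And>k. k \<in> ?I \<Longrightarrow> chain_adj j k \<longleftrightarrow> k \<in> N" for j N and f :: "'a \<Rightarrow> bit"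
  proof -
    have "(\<Sum>u\<in>verts G. of_bool (adj G (l j) u) * f u) = (\<Sum>k\<in>?I. of_bool (adj G (l j) (l k)) * (f \<circ> l) k)"
      using sum.reindex_bij_betw[OF bij, of "\<lambda>u. of_bool (adj G (l j) u) * f u"] by simp
    also have "\<dots> = sum (f \<circ> l) N"
      using that r by (intro sum_of_bool_mult_restrict) auto
    finally show ?thesis .
  qed
  have row_even: "(\<Sum>u\<in>verts G. of_bool (adj G (l (2*i + 2)) u) * f u) = f (l (2*i + 1)) + f (l (2*i + 3))"
    if "i < n" for i and f :: "'a \<Rightarrow> bit"
  proof -
    have "(\<Sum>u\<in>verts G. of_bool (adj G (l (2*i + 2)) u) * f u) = sum (f \<circ> l) {2*i + 1, 2*i + 3}"
      by (rule row) (use that in \<open>simp, simp, simp add: chain_adj_def, presburger\<close>)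
    then show ?thesis by simp
  qed
  have row_first: "(\<Sum>u\<in>verts G. of_bool (adj G (l 1) u) * f u) = f (l 2) + f (l 3)"
    if "1 \<le> n" for f :: "'a \<Rightarrow> bit"
  proof -
    have "(\<Sum>u\<in>verts G. of_bool (adj G (l 1) u) * f u) = sum (f \<circ> l) {2, 3}"
      by (rule row) (use that in \<open>simp, simp, simp add: chain_adj_def, presburger\<close>)
    then show ?thesis by simp
  qed
  have row_odd: "(\<Sum>u\<in>verts G. of_bool (adj G (l (2*i + 3)) u) * f u) =
      f (l (2*i + 1)) + f (l (2*i + 2)) + f (l (2*i + 4)) + f (l (2*i + 5))"
    if "i + 1 < n" for i and f :: "'a \<Rightarrow> bit"
  proof -
    have "(\<Sum>u\<in>verts G. of_bool (adj G (l (2*i + 3)) u) * f u) =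
        sum (f \<circ> l) {2*i + 1, 2*i + 2, 2*i + 4, 2*i + 5}"
      by (rule row) (use that in \<open>simp, simp, simp add: chain_adj_def, presburger\<close>)
    then show ?thesis by (simp add: ac_simps del: add_bit_eq_xor)
  qed
  have row_last: "(\<Sum>u\<in>verts G. of_bool (adj G (l (2*i + 3)) u) * f u) = f (l (2*i + 1)) + f (l (2*i + 2))"
    if "n = i + 1" for i and f :: "'a \<Rightarrow> bit"
  proof -
    have "(\<Sum>u\<in>verts G. of_bool (adj G (l (2*i + 3)) u) * f u) = sum (f \<circ> l) {2*i + 1, 2*i + 2}"
      by (rule row) (use that in \<open>simp, simp, simp add: chain_adj_def, presburger\<close>)
    then show ?thesis by simp
  qed
  have verts: "u \<in> verts G \<longleftrightarrow> (\<exists>j\<in>?I. u = l j)" for u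
    using bij by (auto simp: bij_betw_def)
  have "(\<Sum>u\<in>verts G. of_bool (adj G v u) :: bit) = 0" if vV: "v \<in> verts G" for v
  proof -
    obtain j where j: "j \<in> ?I" "v = l j" using vV unfolding verts by blast
    have "(\<Sum>u\<in>verts G. of_bool (adj G (l j) u) * (1 :: bit)) = 0"
    proof (cases "n = 0")
      case True
      then show ?thesis using j(1) by (subst row[of _ "{}"]) (auto simp: chain_adj_def)
    next
      case n: False
      from j(1) show ?thesis
      proof (cases rule: chain_index_cases)
        case 1
        then show ?thesis using row_first[of "\<lambda>_. 1"] n by simp
      next
        case (2 i)
        then show ?thesis using row_even[of i "\<lambda>_. 1"] by simp
      next
        case (3 i)
        then show ?thesis using row_odd[of i "\<lambda>_. 1"] row_last[of i "\<lambda>_. 1"]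
          by (cases "i + 1 < n") simp_all
      qed
    qed
    then show ?thesis using j by simp
  qed
  moreover have "f u = f w"
    if ker: "\<And>v. v \<in> verts G \<Longrightarrow> (\<Sum>u\<in>verts G. of_bool (adj G v u) * f u) = 0"
      and uw: "u \<in> verts G" "w \<in> verts G" for f :: "'a \<Rightarrow> bit" and u w
  proof -
    have ker': "(\<Sum>u\<in>verts G. of_bool (adj G (l j) u) * f u) = 0" if "j \<in> ?I" for j
      using that by (intro ker) (auto simp only: verts)
    have bit_eq: "a = b" if "a + b = 0" for a b :: bit
      using that by (cases a; cases b) simp_all
    have odd: "i \<le> n \<Longrightarrow> f (l (2*i + 1)) = f (l 1)" for i
    proof (induction i)
      case (Suc i)
      then have "f (l (2*i + 1)) + f (l (2*i + 3)) = 0"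
        using row_even[of i f] ker'[of "2*i + 2"] by simp
      then have "f (l (2*i + 1)) = f (l (2*i + 3))" by (rule bit_eq)
      moreover have "2*Suc i + 1 = 2*i + 3" by simp
      ultimately show ?case using Suc by (metis Suc_leD)
    qed simp
    have even: "i < n \<Longrightarrow> f (l (2*i + 2)) = f (l 1)" for i
    proof (induction i)
      case 0
      then have "f (l 2) + f (l 3) = 0" using row_first[of f] ker'[of 1] by simp
      then have "f (l 2) = f (l 3)" by (rule bit_eq)
      then show ?case using odd[of 1] 0 by (simp add: numeral_2_eq_2 numeral_3_eq_3)
    next
      case (Suc i)
      have "f (l (2*i + 1)) + f (l (2*i + 2)) + f (l (2*i + 4)) + f (l (2*i + 5)) = 0"
        using row_odd[of i f] ker'[of "2*i + 3"] Suc by simp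
      moreover have "2*(i + 2) + 1 = 2*i + 5" by simp
      then have "f (l (2*i + 5)) = f (l 1)" using odd[of "i + 2"] Suc by (metis Suc_leI add_2_eq_Suc')
      moreover have "f (l (2*i + 1)) = f (l 1)" "f (l (2*i + 2)) = f (l 1)" using odd[of i] Suc by simp_all
      ultimately have "f (l 1) + f (l 1) + (f (l (2*i + 4)) + f (l 1)) = 0"
        by (simp only: add.assoc)
      then have "f (l (2*i + 4)) + f (l 1) = 0" by simp
      then have "f (l (2*i + 4)) = f (l 1)" by (rule bit_eq)
      moreover have "2*Suc i + 2 = 2*i + 4" by simp
      ultimately show ?case by metis
    qed
    have const: "f (l j) = f (l 1)" if "j \<in> ?I" for j
      using that
    proof (cases rule: chain_index_cases)
      case (3 i)
      moreover have "2*(i + 1) + 1 = 2*i + 3" by simp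
      ultimately show ?thesis using odd[of "i + 1"] by (metis Suc_eq_plus1 Suc_leI)
    qed (use even in simp_all)
    obtain a b where "a \<in> ?I" "u = l a" "b \<in> ?I" "w = l b"
      using uw unfolding verts by blast
    then show ?thesis using const[of a] const[of b] by simp
  qed
  ultimately have "corank_one G"
    unfolding corank_one_def using fin by blast
  then show ?thesis
    unfolding labelled_def using bij r by blast
qed

section \<open>Number of favorable vertices and conclusion\<close>

lemma card_favorable_le: "card (favorable n) \<le> (n + 3) div 2"
proof -
  have "favorable n \<subseteq> insert 2 ((*) 4 ` {1..(2*n + 1) div 4})"
    by (force simp: favorable_eq)
  then have "card (favorable n) \<le> card (insert 2 ((*) 4 ` {1..(2*n + 1) div 4}))"
    by (intro card_mono) auto
  also have "\<dots> \<le> Suc (card ((*) 4 ` {1..(2*n + 1) div 4}))"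
    by (rule card_insert_le_m1) auto
  also have "card ((*) 4 ` {1..(2*n + 1) div 4}) \<le> (2*n + 1) div 4"
    using card_image_le[of "{1..(2*n + 1) div 4}" "(*) 4"] by simp
  also have "Suc ((2*n + 1) div 4) \<le> (n + 3) div 2" by presburger
  finally show ?thesis by simp
qed

theorem theorem5:
  fixes F :: "'a graph" and B :: "'a set" and n :: nat
  assumes "is_position (F, B)"
    and "n \<ge> 1"
    and "isomorphic_positions (F, B) (triangle_chain n, favorable n)"
  shows "(odd n \<longrightarrow> N_position (F, B)) \<and> (even n \<longrightarrow> P_position (F, B))"
proof -
  obtain f where f: "bij_betw f (verts F) {1..2*n + 1}"
    and adj: "\<And>x y. x \<in> verts F \<Longrightarrow> y \<in> verts F \<Longrightarrow> {x, y} \<in> edges F \<longleftrightarrow> {f x, f y} \<in> edges (triangle_chain n)"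
    and B: "B \<subseteq> verts F" "favorable n = f ` B"
    using assms(3) by (auto simp: isomorphic_positions_def graph_isomorphism_def verts_triangle_chain)
  define l where "l = inv_into (verts F) f"
  have l: "bij_betw l {1..2*n + 1} (verts F)" unfolding l_def using f by (rule bij_betw_inv_into)
  have fl: "f (l j) = j" "l j \<in> verts F" if "j \<in> {1..2*n + 1}" for j
    using that f unfolding l_def by (auto simp: bij_betw_inv_into_right bij_betw_def inv_into_into)
  have "l ` favorable n = B"
    unfolding B(2) l_def using f B(1) by (simp add: bij_betw_def inv_into_image_cancel)
  have chain: "labelled_chain F l n"
  proof (rule labelled_chainI[OF _ l])
    show "finite_graph F" using assms(1) by (simp add: is_position_def)
    show "adj F (l j) (l k) \<longleftrightarrow> chain_adj j k" if "j \<in> {1..2*n + 1}" "k \<in> {1..2*n + 1}" for j k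
      using adj[of "l j" "l k"] fl[OF that(1)] fl[OF that(2)] that by (simp add: adj_def edge_triangle_chain)
  qed
  then have corank: "corank_one F" by (simp only: labelled_def)
  have "card B = card (favorable n)"
    unfolding B(2) using f B(1) by (metis bij_betw_def card_image inj_on_subset)
  then have "card (B \<inter> verts F) \<le> (n + 3) div 2"
    using B(1) card_favorable_le[of n] by (simp add: Int_absorb2)
  \<comment> \<open>A play has \<open>n\<close> moves, so the condition on \<open>q\<close> says
    that TWO moves last.\<close>
  then have TWO: "forces B TWO q F" if "q = TWO \<longleftrightarrow> odd n" for q
    using forces_TWO[OF corank card_labelled_chain[OF chain] assms(2) that] by simp
  have ONE: "forces B ONE (if odd n then ONE else TWO) F"
    using forces_ONE_odd[OF _ chain, of B] forces_ONE_even[OF _ _ chain, of B] \<open>l ` favorable n = B\<close> assms(2)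
    by (cases "odd n") (auto elim!: evenE)
  have "N_position (F, B)" if "odd n"
    unfolding N_position_def
  proof
    \<comment> \<open>For odd \<open>n\<close> the next player also makes the last move, whether
      this is ONE or TWO.\<close>
    fix q show "\<exists>\<sigma>. winning_strategy (F, B) q q \<sigma>"
      using ONE TWO[of TWO] that by (cases q) (auto intro!: forces_imp_winning_strategy)
  qed
  moreover have "P_position (F, B)" if "even n"
    unfolding P_position_def
  proof
    fix q show "\<exists>\<sigma>. winning_strategy (F, B) q (opponent q) \<sigma>"
      using ONE TWO[of ONE] that by (cases q) (auto intro!: forces_imp_winning_strategy)
  qed
  ultimately show ?thesis by blast
qed

end
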